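(* Let $G=\mathbb{Z}/n\mathbb{Z}$ (with $n\ge 1$ an integer) or $G=\mathbb{Z}$. Let $T: L^1(G)\to \mathcal{C}(\hat G)$ be a continuous linear map such that $T(f*g)=T(f)\cdot T(g)$ (pointwise product) for all $f,g\in L^1(G)$. Then there exist a set $E\subset \hat G$ and a map $\sigma:\hat G\to\hat G$ such that, for every $f\in L^1(G)$ and almost every $\eta\in\hat G$, $$T(f)(\eta)=\chi_E(\eta)\,\widehat{f}\bigl(\sigma(\eta)\bigr).$$ Moreover, $\sigma$ is measurable if $G=\mathbb{Z}$.
   Context: Functions are complex valued. $G$ carries the counting measure, so $L^1(\mathbb{Z}/n\mathbb{Z})$ is the space of all functions $\mathbb{Z}/n\mathbb{Z}\to\mathbb{C}$ and $L^1(\mathbb{Z})=\ell^1(\mathbb{Z})$, with norm $\|f\|_1=\sum_{k\in G}|f(k)|$. The convolution is $f*g(x)=\sum_{t\in G}f(t)g(x-t)$. The dual group is $\hat G=\mathbb{Z}/n\mathbb{Z}$ if $G=\mathbb{Z}/n\mathbb{Z}$, and $\hat G=\mathbb{T}=\mathbb{R}/\mathbb{Z}$ if $G=\mathbb{Z}$. The Fourier transform is $\hat f(\eta)=\sum_{k\in G}f(k)e^{-2i\pi k\eta/n}$ if $G=\mathbb{Z}/n\mathbb{Z}$ and $\hat f(\eta)=\sum_{k\in\mathbb{Z}}f(k)e^{-2i\pi k\eta}$ if $G=\mathbb{Z}$. $\mathcal{C}(\hat G)$ denotes the space of all functions on $\mathbb{Z}/n\mathbb{Z}$ ($n$-periodic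 sequences) if $G=\mathbb{Z}/n\mathbb{Z}$, and the space of continuous functions on $\mathbb{T}$ if $G=\mathbb{Z}$, in both cases with the supremum norm. "Almost every" refers to Haar measure on $\hat G$ (counting measure if $\hat G=\mathbb{Z}/n\mathbb{Z}$, Lebesgue measure if $\hat G=\mathbb{T}$). $\chi_E$ is the indicator function of $E$. *)

theory Defs
  imports "HOL-Analysis.Analysis" "Berlekamp_Zassenhaus.Finite_Field"
begin

(* HOL-Analysis declares the same infix for two constants; keep the one of Infinite_Sum. *)
no_notation Infinite_Set_Sum.abs_summable_on (infix \<open>abs'_summable'_on\<close> 50)

section \<open>The algebra \<open>L\<^sup>1(G)\<close> of a discrete abelian group\<close>

text \<open>
  The group is a type: \<^typ>\<open>int\<close> for \<open>\<int>\<close>, and \<open>'n mod_ring\<close> for \<open>\<int>/n\<int>\<close> with \<open>n = CARD('n)\<close>.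
  As \<open>'n\<close> ranges over all finite types, \<open>n\<close> ranges over all integers \<open>n \<ge> 1\<close>.
\<close>

typedef 'g ell1 = "{f :: 'g \<Rightarrow> complex. f abs_summable_on UNIV}"
  morphisms apply_ell1 Abs_ell1
  by (rule exI[of _ "\<lambda>_. 0"]) simp

setup_lifting type_definition_ell1

lemma abs_summable_apply_ell1: "apply_ell1 f abs_summable_on UNIV"
  using apply_ell1[of f] by simp

lemma abs_summable_ell1_add:
  fixes f g :: "'g \<Rightarrow> complex"
  assumes "f abs_summable_on A" "g abs_summable_on A"
  shows "(\<lambda>x. f x + g x) abs_summable_on A"
  using summable_on_add[OF assms] by (rule Infinite_Sum.abs_summable_on_comparison_test') (rule norm_triangle_ineq)

lemma ell1_finite:
  fixes f :: "'g::finite \<Rightarrow> complex"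
  shows "apply_ell1 (Abs_ell1 f) = f"
  by (rule Abs_ell1_inverse) simp

instantiation ell1 :: (type) real_normed_vector
begin

lift_definition zero_ell1 :: "'g ell1" is "\<lambda>_. 0" by simp
lift_definition plus_ell1 :: "'g ell1 \<Rightarrow> 'g ell1 \<Rightarrow> 'g ell1" is "\<lambda>f g x. f x + g x"
  by (rule abs_summable_ell1_add)
lift_definition uminus_ell1 :: "'g ell1 \<Rightarrow> 'g ell1" is "\<lambda>f x. - f x" by simp
lift_definition minus_ell1 :: "'g ell1 \<Rightarrow> 'g ell1 \<Rightarrow> 'g ell1" is "\<lambda>f g x. f x - g x"
proof -
  fix f g :: "'g \<Rightarrow> complex"
  assume "f abs_summable_on UNIV" "g abs_summable_on UNIV"
  then show "(\<lambda>x. f x - g x) abs_summable_on UNIV"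
    using abs_summable_ell1_add[of f UNIV "\<lambda>x. - g x"] by simp
qed
lift_definition scaleR_ell1 :: "real \<Rightarrow> 'g ell1 \<Rightarrow> 'g ell1" is "\<lambda>r f x. r *\<^sub>R f x"
  by (simp add: summable_on_cmult_right)
lift_definition norm_ell1 :: "'g ell1 \<Rightarrow> real" is "\<lambda>f. \<Sum>\<^sub>\<infinity>x. norm (f x)" .

definition dist_ell1 :: "'g ell1 \<Rightarrow> 'g ell1 \<Rightarrow> real" where "dist_ell1 f g = norm (f - g)"
definition sgn_ell1 :: "'g ell1 \<Rightarrow> 'g ell1" where "sgn_ell1 f = inverse (norm f) *\<^sub>R f"
definition uniformity_ell1 :: "('g ell1 \<times> 'g ell1) filter" where
  "uniformity_ell1 = (INF e\<in>{0<..}. principal {(x, y). dist x y < e})"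
definition open_ell1 :: "'g ell1 set \<Rightarrow> bool" where
  "open_ell1 U = (\<forall>x\<in>U. \<forall>\<^sub>F (x', y) in uniformity. x' = x \<longrightarrow> y \<in> U)"

instance
proof
  fix f g h :: "'g ell1" and a b :: real
  show "f + g + h = f + (g + h)" by transfer (simp add: add.assoc)
  show "f + g = g + f" by transfer (simp add: add.commute)
  show "0 + f = f" by transfer simp
  show "- f + f = 0" by transfer simp
  show "f - g = f + - g" by transfer simp
  show "a *\<^sub>R (f + g) = a *\<^sub>R f + a *\<^sub>R g" by transfer (simp add: scaleR_add_right)
  show "(a + b) *\<^sub>R f = a *\<^sub>R f + b *\<^sub>R f" by transfer (simp add: scaleR_add_left)
  show "a *\<^sub>R b *\<^sub>R f = (a * b) *\<^sub>R f" by transfer simp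
  show "1 *\<^sub>R f = f" by transfer simp
  show "dist f g = norm (f - g)" by (rule dist_ell1_def)
  show "sgn f = inverse (norm f) *\<^sub>R f" by (rule sgn_ell1_def)
  show "norm f = 0 \<longleftrightarrow> f = 0"
  proof transfer
    fix f :: "'g \<Rightarrow> complex" assume f: "f abs_summable_on UNIV"
    show "(\<Sum>\<^sub>\<infinity>x. norm (f x)) = 0 \<longleftrightarrow> f = (\<lambda>_. 0)"
    proof
      assume "(\<Sum>\<^sub>\<infinity>x. norm (f x)) = 0"
      then have "norm (f x) = 0" for x
        using nonneg_infsum_le_0D[of "\<lambda>x. norm (f x)" UNIV x] f by simp
      then show "f = (\<lambda>_. 0)" by auto
    qed simp
  qed
  show "norm (f + g) \<le> norm f + norm g"
  proof transfer
    fix f g :: "'g \<Rightarrow> complex"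
    assume f: "f abs_summable_on UNIV" and g: "g abs_summable_on UNIV"
    have "(\<Sum>\<^sub>\<infinity>x. norm (f x + g x)) \<le> (\<Sum>\<^sub>\<infinity>x. norm (f x) + norm (g x))"
      by (intro infsum_mono abs_summable_ell1_add summable_on_add f g norm_triangle_ineq)
    also have "\<dots> = (\<Sum>\<^sub>\<infinity>x. norm (f x)) + (\<Sum>\<^sub>\<infinity>x. norm (g x))"
      by (rule infsum_add[OF f g])
    finally show "(\<Sum>\<^sub>\<infinity>x. norm (f x + g x)) \<le> (\<Sum>\<^sub>\<infinity>x. norm (f x)) + (\<Sum>\<^sub>\<infinity>x. norm (g x))" .
  qed
  show "norm (a *\<^sub>R f) = \<bar>a\<bar> * norm f"
    by transfer (simp add: infsum_cmult_right')
qed (rule uniformity_ell1_def open_ell1_def)+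

end

lift_definition scaleC_ell1 :: "complex \<Rightarrow> 'g ell1 \<Rightarrow> 'g ell1" is "\<lambda>c f x. c * f x"
  by (simp add: norm_mult summable_on_cmult_right)

lemma vector_space_scaleC_ell1: "vector_space scaleC_ell1"
  by standard (transfer; simp add: algebra_simps)+

lemma abs_summable_on_convolution:
  fixes f g :: "'g::ab_group_add \<Rightarrow> complex"
  assumes f: "f abs_summable_on UNIV" and g: "g abs_summable_on UNIV"
  shows "(\<lambda>(x, t). f t * g (x - t)) abs_summable_on UNIV"
    and "(\<lambda>t. f t * g (x - t)) abs_summable_on UNIV"
    and "(\<lambda>x. \<Sum>\<^sub>\<infinity>t. f t * g (x - t)) abs_summable_on UNIV"
proof -
  let ?F = "\<lambda>(x, t). f t * g (x - t)"
  have shift: "(\<lambda>x. norm (g (x - t))) summable_on UNIV"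
    and shift_eq: "(\<Sum>\<^sub>\<infinity>x. norm (g (x - t))) = (\<Sum>\<^sub>\<infinity>x. norm (g x))" for t
  proof -
    have b: "bij_betw (\<lambda>x. x - t) UNIV UNIV"
      by (rule bij_betw_byWitness[of _ "\<lambda>x. x + t"]) auto
    show "(\<lambda>x. norm (g (x - t))) summable_on UNIV"
      using summable_on_reindex_bij_betw[OF b, of "\<lambda>x. norm (g x)"] g by simp
    show "(\<Sum>\<^sub>\<infinity>x. norm (g (x - t))) = (\<Sum>\<^sub>\<infinity>x. norm (g x))"
      using infsum_reindex_bij_betw[OF b, of "\<lambda>x. norm (g x)"] by simp
  qed
  have "(\<lambda>(t, x). f t * g (x - t)) abs_summable_on (SIGMA t:UNIV. UNIV)"
  proof (rule iffD2[OF Infinite_Sum.abs_summable_on_Sigma_iff], intro conjI ballI)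
    show "(\<lambda>x. case (t, x) of (t, x) \<Rightarrow> f t * g (x - t)) abs_summable_on UNIV" for t
      using summable_on_cmult_right[OF shift[of t], of "norm (f t)"] by (simp add: norm_mult)
    have "(\<Sum>\<^sub>\<infinity>x. norm (f t * g (x - t))) = norm (f t) * (\<Sum>\<^sub>\<infinity>x. norm (g x))" for t
      by (simp add: norm_mult infsum_cmult_right' shift_eq)
    then show "(\<lambda>t. \<Sum>\<^sub>\<infinity>x. norm (case (t, x) of (t, x) \<Rightarrow> f t * g (x - t))) abs_summable_on UNIV"
      using summable_on_cmult_left[OF f, of "\<Sum>\<^sub>\<infinity>x. norm (g x)"] by (simp add: infsum_nonneg)
  qed
  then have "(\<lambda>(t, x). f t * g (x - t)) abs_summable_on UNIV"
    by simp
  moreover have "bij_betw prod.swap (UNIV :: ('g \<times> 'g) set) UNIV"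
    by (rule bij_betw_byWitness[of _ prod.swap]) auto
  ultimately show *: "?F abs_summable_on UNIV"
    using summable_on_reindex_bij_betw[of prod.swap UNIV UNIV
        "\<lambda>p. norm ((\<lambda>(t, x). f t * g (x - t)) p)"]
    by (simp add: case_prod_beta)
  then have "?F abs_summable_on (SIGMA x:UNIV. UNIV)"
    by simp
  note S = this[unfolded Infinite_Sum.abs_summable_on_Sigma_iff]
  show 1: "(\<lambda>t. f t * g (x - t)) abs_summable_on UNIV" for x
    using S by simp
  have 2: "(\<lambda>x. \<Sum>\<^sub>\<infinity>t. norm (f t * g (x - t))) summable_on UNIV"
    using S by (simp add: infsum_nonneg)
  show "(\<lambda>x. \<Sum>\<^sub>\<infinity>t. f t * g (x - t)) abs_summable_on UNIV"
    by (rule Infinite_Sum.abs_summable_on_comparison_test'[OF 2]) (rule norm_infsum_bound[OF 1])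
qed

lift_definition convolution :: "'g::ab_group_add ell1 \<Rightarrow> 'g ell1 \<Rightarrow> 'g ell1" (infixl \<open>\<star>\<close> 70)
  is "\<lambda>f g x. \<Sum>\<^sub>\<infinity>t. f t * g (x - t)"
  by (rule abs_summable_on_convolution(3))


section \<open>The dual groups and the spaces \<open>C(G^)\<close>\<close>

text \<open>
  For compact \<open>X\<close>, the type \<open>X \<Rightarrow>\<^sub>C complex\<close> of bounded continuous functions consists of all
  continuous functions on \<open>X\<close>, with the supremum norm. The group \<open>\<int>/n\<int>\<close>, which is its own
  dual, is given the discrete topology.
\<close>

instantiation mod_ring :: (finite) discrete_topology
begin

definition open_mod_ring :: "'a mod_ring set \<Rightarrow> bool" where "open_mod_ring U = True"

instance by standard (simp_all add: open_mod_ring_def)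

end

lemma bcontfun_mod_ring: "(bcontfun :: ('n::finite mod_ring \<Rightarrow> complex) set) = UNIV"
  by (auto simp: bcontfun_def intro: finite_imp_bounded)

definition circle_rel :: "real \<Rightarrow> real \<Rightarrow> bool" where
  "circle_rel x y \<longleftrightarrow> x - y \<in> \<int>"

lemma equivp_circle_rel: "equivp circle_rel"
proof (rule equivpI)
  show "reflp circle_rel"
    by (rule reflpI) (simp add: circle_rel_def)
  show "symp circle_rel"
    by (rule sympI) (metis circle_rel_def Ints_minus minus_diff_eq)
  show "transp circle_rel"
    by (rule transpI) (metis circle_rel_def Ints_add diff_add_cancel add_diff_eq)
qed

quotient_type circle = real / circle_rel
  by (rule equivp_circle_rel)

instantiation circle :: topological_space
begin

definition open_circle :: "circle set \<Rightarrow> bool" where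
  "open_circle U \<longleftrightarrow> open (abs_circle -` U)"

instance
proof
  show "open (UNIV :: circle set)" by (simp add: open_circle_def)
  show "open (S \<inter> T)" if "open S" "open T" for S T :: "circle set"
    using that by (simp add: open_circle_def vimage_Int open_Int)
  show "open (\<Union>K)" if "\<forall>S\<in>K. open S" for K :: "circle set set"
    using that by (auto simp: open_circle_def vimage_Union)
qed

end

lemma continuous_on_abs_circle: "continuous_on UNIV abs_circle"
  by (simp add: continuous_on_open_vimage open_circle_def)

lemma abs_circle_frac: "abs_circle (frac x) = abs_circle x"
  by (simp add: circle.abs_eq_iff circle_rel_def frac_def)

lemma range_abs_circle: "abs_circle ` {0..1} = UNIV"
proof -
  have "c \<in> abs_circle ` {0..1}" for c
  proof -
    obtain x where "c = abs_circle x"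
      using Quotient_abs_rep[OF Quotient_circle, of c] by metis
    then have "c = abs_circle (frac x)" by (simp add: abs_circle_frac)
    moreover have "frac x \<in> {0..1}" using frac_ge_0[of x] frac_lt_1[of x] by simp
    ultimately show ?thesis by blast
  qed
  then show ?thesis by auto
qed

lemma compact_circle: "compact (UNIV :: circle set)"
  using compact_continuous_image[OF continuous_on_subset[OF continuous_on_abs_circle] compact_Icc[of 0 1]]
  by (simp add: range_abs_circle)

lemma bcontfun_circle: "(bcontfun :: (circle \<Rightarrow> complex) set) = {f. continuous_on UNIV f}"
  using compact_continuous_image[OF _ compact_circle]
  by (auto simp: bcontfun_def intro: compact_imp_bounded)

definition haar_circle :: "circle measure" where
  "haar_circle = distr (restrict_space lborel {0..<1}) borel abs_circle"

definition scaleC_bcontfun ::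
    "complex \<Rightarrow> ('a::topological_space \<Rightarrow>\<^sub>C complex) \<Rightarrow> ('a \<Rightarrow>\<^sub>C complex)" where
  "scaleC_bcontfun c f = Bcontfun (\<lambda>x. c * f x)"

lemma apply_scaleC_bcontfun: "scaleC_bcontfun c f x = c * f x"
proof -
  have "bounded ((\<lambda>z. c * z) ` range f)"
    by (intro bounded_linear_image bounded_linear_mult_right) simp
  then have "(\<lambda>x. c * f x) \<in> bcontfun"
    by (auto simp: bcontfun_def image_image intro: continuous_intros)
  then show ?thesis
    by (simp add: scaleC_bcontfun_def Bcontfun_inverse)
qed

lemma vector_space_scaleC_bcontfun:
  "vector_space (scaleC_bcontfun :: complex \<Rightarrow> ('a::topological_space \<Rightarrow>\<^sub>C complex) \<Rightarrow> _)"
  by standard (rule bcontfun_eqI; simp add: apply_scaleC_bcontfun plus_bcontfun.rep_eq algebra_simps)+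


section \<open>Fourier transforms\<close>

text \<open>The exponential does not depend on the choice of the integer representatives of \<open>k\<close> and \<open>\<eta>\<close>.\<close>

definition fourier_cyclic :: "'n::finite mod_ring ell1 \<Rightarrow> 'n mod_ring \<Rightarrow> complex" where
  "fourier_cyclic f \<eta> = (\<Sum>k\<in>UNIV. apply_ell1 f k *
     exp (- 2 * \<i> * of_real pi * of_int (to_int_mod_ring k) * of_int (to_int_mod_ring \<eta>)
       / of_nat CARD('n)))"

lemma exp_int_periodic:
  fixes x y :: real and k :: int
  assumes "x - y \<in> \<int>"
  shows "exp (- 2 * \<i> * of_real pi * of_int k * of_real x) = exp (- 2 * \<i> * of_real pi * of_int k * of_real y)"
proof -
  obtain m :: int where "x - y = of_int m" using assms by (auto elim: Ints_cases)
  then have "x = y + of_int m" by simp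
  then have "- 2 * \<i> * of_real pi * of_int k * of_real x =
      - 2 * \<i> * of_real pi * of_int k * of_real y + (of_int (2 * (- (k * m))) * pi) * \<i>"
    by (simp add: algebra_simps)
  then show ?thesis
    unfolding exp_eq by blast
qed

lift_definition fourier_int :: "int ell1 \<Rightarrow> circle \<Rightarrow> complex"
  is "\<lambda>f x. \<Sum>\<^sub>\<infinity>k. f k * exp (- 2 * \<i> * of_real pi * of_int k * of_real x)"
  by (simp only: circle_rel_def exp_int_periodic)

end

theory Submission
  imports Defs
begin

text \<open>
  For a fixed frequency \<open>\<eta>\<close>, the functional \<open>f \<mapsto> T f \<eta>\<close> is a continuous, complex linear and
  multiplicative functional \<open>\<phi>\<close> on the convolution algebra. Such functionals are either zero or
  integrate against a unitary character of the group, and the unitary characters are precisely the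
  points of the dual group. So the formula holds at every \<open>\<eta>\<close> separately, and only the measurability
  of \<open>\<sigma>\<close> relates different frequencies.

  The point masses carry the argument. They satisfy \<open>\<delta>\<^sub>x \<star> \<delta>\<^sub>y = \<delta>\<^bsub>x+y\<^esub>\<close>, and \<open>\<delta>\<^sub>0\<close> is the unit
  of the algebra. Hence \<open>\<phi> \<delta>\<^sub>0\<close> is an idempotent complex number. If it is \<open>0\<close>, then \<open>\<phi> = 0\<close>
  (lemma \<open>eq_0_if_unit\<close>). If it is \<open>1\<close>, then \<open>\<chi> x = \<phi> \<delta>\<^sub>x\<close> is a homomorphism into the nonzero complex
  numbers; it is bounded because the \<open>\<delta>\<^sub>x\<close> all have norm \<open>1\<close> and \<open>\<phi>\<close> is continuous, and a bounded
  homomorphism has values of modulus \<open>1\<close> (lemma \<open>norm_delta_eq_1\<close>). The point masses span a dense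
  subspace, so \<open>\<phi> f = (\<Sum>\<^sub>x f x * \<chi> x)\<close> (lemma \<open>expansion\<close>).

  The set \<open>E\<close> consists of the \<open>\<eta>\<close> with \<open>T \<delta>\<^sub>0 \<eta> = 1\<close>. Both groups are generated by the image of \<open>1\<close>, so
  that \<open>\<chi>\<close> is determined by the single number \<open>T \<delta>\<^sub>1 \<eta>\<close>, whose angle is \<open>\<sigma> \<eta>\<close>. As \<open>T \<delta>\<^sub>1\<close> is a
  continuous function on the circle and the angle is a Borel function of a complex number, \<open>\<sigma>\<close> is
  measurable. For the cyclic group of order \<open>n\<close>, the angle is a multiple of \<open>1/n\<close> because \<open>n\<close> times
  the generator is zero.
\<close>


section \<open>Point masses in the convolution algebra\<close>

lift_definition delta :: "'g \<Rightarrow> 'g ell1" is "\<lambda>x y. of_bool (y = x)"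
proof -
  fix x :: 'g
  show "(\<lambda>y. of_bool (y = x) :: complex) abs_summable_on UNIV"
    by (rule iffD1[OF summable_on_cong_neutral summable_on_finite[of "{x}"]]) auto
qed

lemma apply_delta: "apply_ell1 (delta x) y = of_bool (y = x)"
  by transfer simp

lemma norm_delta: "norm (delta x) = 1"
proof -
  have "(\<Sum>\<^sub>\<infinity>y. norm (of_bool (y = x) :: complex)) = (\<Sum>\<^sub>\<infinity>y\<in>{x}. 1)"
    by (rule infsum_cong_neutral) auto
  then show ?thesis by transfer simp
qed

lemma apply_delta_convolution: "apply_ell1 (delta x \<star> f) y = apply_ell1 f (y - x)"
proof -
  have "(\<Sum>\<^sub>\<infinity>t. apply_ell1 (delta x) t * apply_ell1 f (y - t)) =
      (\<Sum>\<^sub>\<infinity>t\<in>{x}. apply_ell1 f (y - t))"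
    by (rule infsum_cong_neutral) (auto simp: apply_delta)
  then show ?thesis by (simp add: convolution.rep_eq)
qed

lemma delta_convolution_delta: "delta x \<star> delta y = delta (x + y)"
  by (intro iffD1[OF apply_ell1_inject] ext)
    (simp add: apply_delta_convolution apply_delta diff_eq_eq add.commute)

lemma delta_0_convolution: "delta 0 \<star> f = f"
  by (intro iffD1[OF apply_ell1_inject] ext) (simp add: apply_delta_convolution)

lemma apply_sum_ell1: "apply_ell1 (\<Sum>i\<in>I. g i) y = (\<Sum>i\<in>I. apply_ell1 (g i) y)"
  by (induction I rule: infinite_finite_induct) (simp_all add: zero_ell1.rep_eq plus_ell1.rep_eq)

text \<open>
  The remainder after the terms in a finite set \<open>F\<close> is the restriction of \<open>f\<close> to the complement of
  \<open>F\<close>, so that its norm is a tail of the convergent sum of the \<open>norm (f k)\<close>.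
\<close>

lemma has_sum_delta: "((\<lambda>k. scaleC_ell1 (apply_ell1 f k) (delta k)) has_sum f) UNIV"
proof -
  let ?a = "\<lambda>k. norm (apply_ell1 f k)"
  have remainder: "norm ((\<Sum>k\<in>F. scaleC_ell1 (apply_ell1 f k) (delta k)) - f) = infsum ?a UNIV - sum ?a F"
    if "finite F" for F
  proof -
    let ?s = "\<Sum>k\<in>F. scaleC_ell1 (apply_ell1 f k) (delta k)"
    have coeff: "apply_ell1 ?s y = (if y \<in> F then apply_ell1 f y else 0)" for y
      using that by (simp add: apply_sum_ell1 scaleC_ell1.rep_eq apply_delta of_bool_def if_distrib
        cong: if_cong)
    have "norm (?s - f) = (\<Sum>\<^sub>\<infinity>y. norm (apply_ell1 ?s y - apply_ell1 f y))"
      by (simp add: norm_ell1.rep_eq minus_ell1.rep_eq)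
    also have "\<dots> = infsum ?a (UNIV - F)"
      by (rule infsum_cong_neutral) (auto simp: coeff)
    also have "\<dots> = infsum ?a UNIV - infsum ?a F"
      using that by (intro infsum_Diff abs_summable_apply_ell1 summable_on_finite) auto
    finally show ?thesis using that by simp
  qed
  have "((\<lambda>F. infsum ?a UNIV - sum ?a F) \<longlongrightarrow> infsum ?a UNIV - infsum ?a UNIV) (finite_subsets_at_top UNIV)"
    using has_sum_infsum[OF abs_summable_apply_ell1[of f]]
    by (intro tendsto_diff tendsto_const) (simp add: has_sum_def)
  then have "((\<lambda>F. infsum ?a UNIV - sum ?a F) \<longlongrightarrow> 0) (finite_subsets_at_top UNIV)"
    by simp
  then have "((\<lambda>F. norm ((\<Sum>k\<in>F. scaleC_ell1 (apply_ell1 f k) (delta k)) - f)) \<longlongrightarrow> 0)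
      (finite_subsets_at_top UNIV)"
    by (rule Lim_transform_eventually)
      (auto simp: remainder)
  then show ?thesis
    unfolding has_sum_def by (simp add: LIM_zero_iff tendsto_norm_zero_iff)
qed


section \<open>Continuous multiplicative functionals\<close>

locale ell1_character =
  fixes \<phi> :: "'g::ab_group_add ell1 \<Rightarrow> complex"
  assumes add: "\<phi> (f + g) = \<phi> f + \<phi> g"
    and scale: "\<phi> (scaleC_ell1 c f) = c * \<phi> f"
    and continuous: "continuous_on UNIV \<phi>"
    and mult: "\<phi> (f \<star> g) = \<phi> f * \<phi> g"
begin

lemma expansion: "\<phi> f = (\<Sum>\<^sub>\<infinity>k. apply_ell1 f k * \<phi> (delta k))"
proof -
  have "isCont \<phi> f"
    using continuous by (simp add: continuous_on_eq_continuous_at)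
  then have "((\<phi> \<circ> (\<lambda>k. scaleC_ell1 (apply_ell1 f k) (delta k))) has_sum \<phi> f) UNIV"
    by (intro has_sum_comm_additive has_sum_delta) (simp_all add: Modules.additive_def add isCont_def)
  then have "((\<lambda>k. apply_ell1 f k * \<phi> (delta k)) has_sum \<phi> f) UNIV"
    by (simp add: o_def scale)
  then show ?thesis by (rule infsumI[symmetric])
qed

lemma delta_add: "\<phi> (delta (x + y)) = \<phi> (delta x) * \<phi> (delta y)"
  by (simp add: delta_convolution_delta[symmetric] mult)

lemma eq_0_if_unit:
  assumes "\<phi> (delta 0) \<noteq> 1"
  shows "\<phi> f = 0"
proof -
  have "\<phi> (delta 0) = \<phi> (delta 0) * \<phi> (delta 0)"
    using delta_add[of 0 0] by simp
  then have "\<phi> (delta 0) = 0" using assms by auto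
  moreover have "\<phi> f = \<phi> (delta 0) * \<phi> f"
    using mult[of "delta 0" f] by (simp add: delta_0_convolution)
  ultimately show ?thesis by simp
qed

lemma bounded_delta: "\<exists>C. \<forall>x. norm (\<phi> (delta x)) \<le> C"
proof -
  have zero: "\<phi> 0 = 0" using add[of 0 0] by simp
  have "isCont \<phi> 0"
    using continuous by (simp add: continuous_on_eq_continuous_at)
  then obtain d where d: "d > 0" "\<And>f. norm f < d \<Longrightarrow> norm (\<phi> f) < 1"
    unfolding continuous_at_eps_delta dist_norm using zero zero_less_one by (metis diff_zero)
  have "norm (\<phi> (delta x)) \<le> 2 / d" for x
  proof -
    have "scaleC_ell1 (of_real (d/2)) (delta x) = (d/2) *\<^sub>R delta x"
      by transfer (simp add: scaleR_conv_of_real)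
    then have "norm (scaleC_ell1 (of_real (d/2)) (delta x)) < d"
      using d(1) by (simp add: norm_delta)
    from d(2)[OF this] show ?thesis
      using d(1) by (simp add: scale norm_mult field_simps)
  qed
  then show ?thesis by blast
qed

text \<open>
  If one value of the character had modulus greater than \<open>1\<close>, its powers, which are again values of
  the character, would be unbounded. Apply this to \<open>x\<close> and to \<open>- x\<close>.
\<close>

lemma norm_delta_eq_1:
  assumes unit: "\<phi> (delta 0) = 1"
  shows "norm (\<phi> (delta x)) = 1"
proof -
  obtain C where C: "\<And>x. norm (\<phi> (delta x)) \<le> C"
    using bounded_delta by blast
  have le: "norm (\<phi> (delta y)) \<le> 1" for y
  proof (rule ccontr)
    assume "\<not> norm (\<phi> (delta y)) \<le> 1"
    then obtain n where n: "C < norm (\<phi> (delta y)) ^ n"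
      using real_arch_pow[of "norm (\<phi> (delta y))" C] by auto
    have "\<exists>z. \<phi> (delta z) = \<phi> (delta y) ^ n"
    proof (induction n)
      case 0
      show ?case using unit by auto
    next
      case (Suc n)
      then obtain z where "\<phi> (delta z) = \<phi> (delta y) ^ n" by blast
      then have "\<phi> (delta (y + z)) = \<phi> (delta y) ^ Suc n" by (simp add: delta_add)
      then show ?case by blast
    qed
    then show False using n C by (metis norm_power not_less)
  qed
  have "norm (\<phi> (delta x)) * norm (\<phi> (delta (- x))) = 1"
    using delta_add[of x "- x"] unit by (simp flip: norm_mult)
  then show ?thesis
    using le[of x] le[of "- x"] mult_left_le[of "norm (\<phi> (delta (- x)))" "norm (\<phi> (delta x))"] by simp
qed

end

lemma ell1_character_eval:
  fixes T :: "'g::ab_group_add ell1 \<Rightarrow> ('a::topological_space \<Rightarrow>\<^sub>C complex)"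
  assumes lin: "Vector_Spaces.linear scaleC_ell1 scaleC_bcontfun T"
    and cont: "continuous_on UNIV T"
    and mult: "\<And>f g \<eta>. T (f \<star> g) \<eta> = T f \<eta> * T g \<eta>"
  shows "ell1_character (\<lambda>f. T f \<eta>)"
proof
  interpret Vector_Spaces.linear scaleC_ell1 scaleC_bcontfun T by (rule lin)
  show "T (f + g) \<eta> = T f \<eta> + T g \<eta>" for f g
    by (simp add: add)
  show "T (scaleC_ell1 c f) \<eta> = c * T f \<eta>" for c f
    by (simp add: scale apply_scaleC_bcontfun)
  have "continuous_on UNIV (\<lambda>F :: 'a \<Rightarrow>\<^sub>C complex. F \<eta>)"
    unfolding continuous_on_iff using dist_bounded order_le_less_trans by blast
  from continuous_on_compose2[OF this cont] show "continuous_on UNIV (\<lambda>f. T f \<eta>)" by simp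
qed (rule mult)


section \<open>Unitary characters as exponentials\<close>

text \<open>
  The angle of a unit complex number, measured in turns and with the sign of the Fourier transform.
\<close>

definition angle :: "complex \<Rightarrow> real" where
  "angle z = - Arg z / (2 * pi)"

lemma exp_angle:
  assumes "norm z = 1"
  shows "exp (- 2 * \<i> * of_real pi * of_real (angle z)) = z"
proof -
  have "- 2 * \<i> * of_real pi * of_real (angle z) = \<i> * of_real (Arg z)"
    by (simp add: angle_def)
  then show ?thesis using assms complex_norm_eq_1_exp_eq by metis
qed

text \<open>
  \<open>Arg\<close> is continuous off the closed negative half line, constant on the open one, and
  changing a function at the single point \<open>0\<close> does not affect its measurability.
\<close>

lemma borel_measurable_angle [measurable]: "angle \<in> borel_measurable borel"
proof -
  have *: "(\<lambda>z. if z \<in> - \<real>\<^sub>\<le>\<^sub>0 then Arg z else pi) \<in> borel_measurable borel"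
    by (rule borel_measurable_continuous_on_if) (auto intro!: continuous_on_Arg borel_open)
  have "(\<lambda>z. if z = 0 then Arg 0 else if z \<in> - \<real>\<^sub>\<le>\<^sub>0 then Arg z else pi) \<in> borel_measurable borel"
    by (intro measurable_If * measurable_const) simp_all
  also have "(\<lambda>z. if z = 0 then Arg 0 else if z \<in> - \<real>\<^sub>\<le>\<^sub>0 then Arg z else pi) = Arg"
  proof (intro ext)
    show "(if z = 0 then Arg 0 else if z \<in> - \<real>\<^sub>\<le>\<^sub>0 then Arg z else pi) = Arg z" for z
      using Arg_eq_pi[of z] complex_eq_iff[of z 0] by (auto simp: complex_nonpos_Reals_iff)
  qed
  finally have [measurable]: "Arg \<in> borel_measurable borel" .
  show ?thesis unfolding angle_def by measurable
qed

lemma int_character_eq_exp: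
  fixes \<psi> :: "int \<Rightarrow> complex"
  assumes add: "\<And>j k. \<psi> (j + k) = \<psi> j * \<psi> k" and norm: "norm (\<psi> 1) = 1"
  shows "\<psi> k = exp (- 2 * \<i> * of_real pi * of_int k * of_real (angle (\<psi> 1)))"
proof -
  let ?e = "\<lambda>k::int. exp (- 2 * \<i> * of_real pi * of_int k * of_real (angle (\<psi> 1)))"
  have step: "?e (j + 1) = ?e j * \<psi> 1" for j
  proof -
    have "- 2 * \<i> * of_real pi * of_int (j + 1) * of_real (angle (\<psi> 1)) =
        - 2 * \<i> * of_real pi * of_int j * of_real (angle (\<psi> 1)) +
        - 2 * \<i> * of_real pi * of_real (angle (\<psi> 1))"
      by (simp add: algebra_simps)
    then show ?thesis by (simp only: exp_add exp_angle[OF norm])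
  qed
  have nz: "\<psi> 1 \<noteq> 0" using norm by auto
  show ?thesis
  proof (induction k rule: int_induct[of _ 0])
    case base
    show ?case using add[of 0 1] nz by simp
  next
    case (step1 i)
    then show ?case by (simp only: step add)
  next
    case (step2 i)
    have "\<psi> (i - 1) * \<psi> 1 = \<psi> i" using add[of "i - 1" 1] by simp
    moreover have "?e (i - 1) * \<psi> 1 = ?e i" using step[of "i - 1"] by simp
    ultimately show ?case using step2 nz by (metis mult_right_cancel)
  qed
qed

text \<open>
  The homomorphism \<open>h\<close> is the identity for the integers and reduction modulo \<open>n\<close> for the cyclic
  group, which allows one exponential formula for both groups.
\<close>

lemma (in ell1_character) delta_eq_exp:
  assumes unit: "\<phi> (delta 0) = 1" and h: "\<And>j k :: int. h (j + k) = h j + h k"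
  shows "\<phi> (delta (h k)) =
    exp (- 2 * \<i> * of_real pi * of_int k * of_real (angle (\<phi> (delta (h 1)))))"
  by (rule int_character_eq_exp[of "\<lambda>k. \<phi> (delta (h k))"])
    (simp_all add: h delta_add norm_delta_eq_1[OF unit])

lemma fourier_int_abs_circle:
  "fourier_int f (abs_circle x) =
    (\<Sum>\<^sub>\<infinity>k. apply_ell1 f k * exp (- 2 * \<i> * of_real pi * of_int k * of_real x))"
  by transfer simp

lemma int_character_eq_fourier:
  fixes \<phi> :: "int ell1 \<Rightarrow> complex"
  assumes "ell1_character \<phi>"
  shows "\<phi> f = of_bool (\<phi> (delta 0) = 1) * fourier_int f (abs_circle (angle (\<phi> (delta 1))))"
proof -
  interpret ell1_character \<phi> by fact
  show ?thesis
  proof (cases "\<phi> (delta 0) = 1")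
    case True
    have "apply_ell1 f k * \<phi> (delta k) = apply_ell1 f k *
        exp (- 2 * \<i> * of_real pi * of_int k * of_real (angle (\<phi> (delta 1))))" for k
      by (rule arg_cong[OF delta_eq_exp[where h = "\<lambda>k. k", OF True refl]])
    then have "\<phi> f = fourier_int f (abs_circle (angle (\<phi> (delta 1))))"
      unfolding fourier_int_abs_circle by (subst expansion) (rule infsum_cong)
    then show ?thesis using True by simp
  qed (simp add: eq_0_if_unit)
qed

lemma of_int_mod_ring_add:
  "of_int_mod_ring (j + k) = (of_int_mod_ring j + of_int_mod_ring k :: 'n::finite mod_ring)"
  by transfer (simp add: mod_add_eq)

lemma of_int_mod_ring_card: "of_int_mod_ring (int CARD('n)) = (0 :: 'n::finite mod_ring)"
  by transfer simp

lemma to_int_mod_ring_of_int_mod_ring_mod: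
  "to_int_mod_ring (of_int_mod_ring m :: 'n::finite mod_ring) = m mod int CARD('n)"
  by transfer simp

text \<open>
  Since \<open>n\<close> is zero in the cyclic group, \<open>n\<close> times the angle of the generator is an integer \<open>m\<close>.
  Its residue is the frequency; passing from \<open>m\<close> to the representative \<open>m mod n\<close> changes the
  exponents by multiples of \<open>2 \<pi> \<i>\<close>.
\<close>

lemma cyclic_character_eq_fourier:
  fixes \<phi> :: "'n::finite mod_ring ell1 \<Rightarrow> complex"
  assumes "ell1_character \<phi>"
  shows "\<exists>\<xi>. \<forall>f. \<phi> f = of_bool (\<phi> (delta 0) = 1) * fourier_cyclic f \<xi>"
proof -
  interpret ell1_character \<phi> by fact
  show ?thesis
  proof (cases "\<phi> (delta 0) = 1")
    case True
    let ?n = "int CARD('n)"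
    let ?h = "of_int_mod_ring :: int \<Rightarrow> 'n mod_ring"
    define \<theta> where "\<theta> = angle (\<phi> (delta (?h 1)))"
    have char: "\<phi> (delta (?h k)) = exp (- 2 * \<i> * of_real pi * of_int k * of_real \<theta>)" for k
      unfolding \<theta>_def by (rule delta_eq_exp[where h = ?h, OF True of_int_mod_ring_add])
    have "?h ?n = 0" by (rule of_int_mod_ring_card)
    then have "exp (- 2 * \<i> * of_real pi * of_int ?n * of_real \<theta>) = 1"
      using char[of ?n] True by simp
    then obtain l :: int where "- 2 * pi * ?n * \<theta> = of_int (2 * l) * pi"
      by (auto simp: exp_eq_1)
    then have "pi * (?n * \<theta>) = pi * - of_int l" by (simp add: mult_ac)
    then have l: "?n * \<theta> = - of_int l" by (simp only: mult_cancel_left) simp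
    define m where "m = - l"
    have \<theta>: "\<theta> = of_int m / of_int ?n" using l by (simp add: m_def field_simps)
    have "\<phi> f = fourier_cyclic f (?h m)" for f
    proof -
      have "\<phi> (delta x) = exp (- 2 * \<i> * of_real pi * of_int (to_int_mod_ring x) *
          of_int (to_int_mod_ring (?h m)) / of_nat CARD('n))" for x
      proof -
        let ?k = "to_int_mod_ring x"
        have "to_int_mod_ring (?h m) = m mod ?n" by (rule to_int_mod_ring_of_int_mod_ring_mod)
        moreover have "real_of_int m = of_int ?n * of_int (m div ?n) + of_int (m mod ?n)"
          by (simp only: mult_div_mod_eq flip: of_int_mult of_int_add)
        ultimately have "\<theta> - of_int (to_int_mod_ring (?h m)) / of_int ?n = of_int (m div ?n)"
          unfolding \<theta> by (simp add: field_simps)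
        then have "\<theta> - of_int (to_int_mod_ring (?h m)) / of_int ?n \<in> \<int>" by simp
        from exp_int_periodic[OF this, of ?k] show ?thesis
          using char[of ?k] by simp
      qed
      then show ?thesis
        using expansion[of f] by (simp add: fourier_cyclic_def)
    qed
    then show ?thesis using True by auto
  qed (simp add: eq_0_if_unit)
qed


section \<open>Multiplicative maps into the functions on the dual group\<close>

theorem theorem2p1:
  fixes S :: "'n::finite mod_ring ell1 \<Rightarrow> ('n mod_ring \<Rightarrow>\<^sub>C complex)"
    and T :: "int ell1 \<Rightarrow> (circle \<Rightarrow>\<^sub>C complex)"
  shows
    "(Vector_Spaces.linear scaleC_ell1 scaleC_bcontfun S \<and> continuous_on UNIV S \<and>
      (\<forall>f g \<eta>. S (f \<star> g) \<eta> = S f \<eta> * S g \<eta>)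
      \<longrightarrow> (\<exists>(E :: 'n mod_ring set) (\<sigma> :: 'n mod_ring \<Rightarrow> 'n mod_ring).
            \<forall>f. AE \<eta> in count_space UNIV. S f \<eta> = indicator E \<eta> * fourier_cyclic f (\<sigma> \<eta>)))
     \<and>
     (Vector_Spaces.linear scaleC_ell1 scaleC_bcontfun T \<and> continuous_on UNIV T \<and>
      (\<forall>f g \<eta>. T (f \<star> g) \<eta> = T f \<eta> * T g \<eta>)
      \<longrightarrow> (\<exists>(E :: circle set) (\<sigma> :: circle \<Rightarrow> circle). \<sigma> \<in> borel_measurable borel \<and>
            (\<forall>f. AE \<eta> in haar_circle. T f \<eta> = indicator E \<eta> * fourier_int f (\<sigma> \<eta>))))"
proof (intro conjI impI; elim conjE)
  assume "Vector_Spaces.linear scaleC_ell1 scaleC_bcontfun S" "continuous_on UNIV S"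
    "\<forall>f g \<eta>. S (f \<star> g) \<eta> = S f \<eta> * S g \<eta>"
  then have "\<exists>\<xi>. \<forall>f. S f \<eta> = of_bool (S (delta 0) \<eta> = 1) * fourier_cyclic f \<xi>" for \<eta>
    by (intro cyclic_character_eq_fourier[of "\<lambda>f. S f \<eta>"] ell1_character_eval) auto
  then have "\<forall>\<eta>. \<exists>\<xi>. \<forall>f. S f \<eta> = of_bool (S (delta 0) \<eta> = 1) * fourier_cyclic f \<xi>"
    by blast
  from choice[OF this] obtain \<sigma>
    where "\<forall>\<eta> f. S f \<eta> = of_bool (S (delta 0) \<eta> = 1) * fourier_cyclic f (\<sigma> \<eta>)" ..
  then have "S f \<eta> = indicator {\<eta>. S (delta 0) \<eta> = 1} \<eta> * fourier_cyclic f (\<sigma> \<eta>)" for f \<eta>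
    unfolding indicator_def mem_Collect_eq by iprover
  then have "\<forall>f. AE \<eta> in count_space UNIV.
      S f \<eta> = indicator {\<eta>. S (delta 0) \<eta> = 1} \<eta> * fourier_cyclic f (\<sigma> \<eta>)"
    by (intro allI AE_I2)
  then show "\<exists>E \<sigma>. \<forall>f. AE \<eta> in count_space UNIV. S f \<eta> = indicator E \<eta> * fourier_cyclic f (\<sigma> \<eta>)"
    by blast
next
  assume "Vector_Spaces.linear scaleC_ell1 scaleC_bcontfun T" "continuous_on UNIV T"
    "\<forall>f g \<eta>. T (f \<star> g) \<eta> = T f \<eta> * T g \<eta>"
  then have eval: "T f \<eta> = of_bool (T (delta 0) \<eta> = 1) *
      fourier_int f (abs_circle (angle (T (delta 1) \<eta>)))" for f \<eta>
    by (intro int_character_eq_fourier[of "\<lambda>f. T f \<eta>"] ell1_character_eval) auto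
  let ?E = "{\<eta>. T (delta 0) \<eta> = 1}" and ?\<sigma> = "\<lambda>\<eta>. abs_circle (angle (T (delta 1) \<eta>))"
  have "abs_circle \<in> borel_measurable borel" "apply_bcontfun (T (delta 1)) \<in> borel_measurable borel"
    by (intro borel_measurable_continuous_onI continuous_on_abs_circle continuous_on_apply_bcontfun)+
  then have "?\<sigma> \<in> borel_measurable borel" by measurable
  moreover have "T f \<eta> = indicator ?E \<eta> * fourier_int f (?\<sigma> \<eta>)" for f \<eta>
    unfolding indicator_def mem_Collect_eq by (rule eval)
  then have "\<forall>f. AE \<eta> in haar_circle. T f \<eta> = indicator ?E \<eta> * fourier_int f (?\<sigma> \<eta>)"
    by (intro allI AE_I2)
  ultimately show "\<exists>E \<sigma>. \<sigma> \<in> borel_measurable borel \<and>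
      (\<forall>f. AE \<eta> in haar_circle. T f \<eta> = indicator E \<eta> * fourier_int f (\<sigma> \<eta>))"
    by blast
qed

end
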